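(* Let $F$ be a CNF formula. If $F$ has a Hitting refutation of size $m$ (i.e., consisting of $m$ clauses), then $F$ has a tree-like resolution refutation of size at most $O(2^{2\log^3 m})$.
   Context: A clause is a disjunction of literals, viewed as a set of literals; a CNF is a conjunction (set) of clauses. A hitting formula is a CNF $H=C_1\wedge\dots\wedge C_m$ such that every two distinct clauses $C_i,C_j$ contain complementary literals (some literal $\ell\in C_i$ with $\bar\ell\in C_j$). A Hitting refutation of a CNF $F$ is an unsatisfiable hitting formula $H$ such that every clause $C$ of $H$ has a clause $C'\subseteq C$ belonging to $F$; its size is the number of clauses of $H$. Tree-like resolution refutations are resolution refutations (resolution rule: from $C\vee x$ and $D\vee\bar x$ derive $C\vee D$) in which every derived clause is used at most once as a premise; size is the number of clauses in the refutation. Logarithms are base 2. *)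

theory Defs
  imports Complex_Main
begin

datatype 'v literal = Pos 'v | Neg 'v

fun complement :: "'v literal \<Rightarrow> 'v literal" where
  "complement (Pos x) = Neg x"
| "complement (Neg x) = Pos x"

type_synonym 'v clause = "'v literal set"
type_synonym 'v cnf = "'v clause set"

text \<open>Tautological clauses (containing a literal and its complement) are not excluded.\<close>

definition is_cnf :: "'v cnf \<Rightarrow> bool" where
  "is_cnf F \<longleftrightarrow> finite F \<and> (\<forall>C\<in>F. finite C)"

fun sat_literal :: "('v \<Rightarrow> bool) \<Rightarrow> 'v literal \<Rightarrow> bool" where
  "sat_literal a (Pos x) \<longleftrightarrow> a x"
| "sat_literal a (Neg x) \<longleftrightarrow> \<not> a x"

definition sat_cnf :: "('v \<Rightarrow> bool) \<Rightarrow> 'v cnf \<Rightarrow> bool" where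
  "sat_cnf a F \<longleftrightarrow> (\<forall>C\<in>F. \<exists>l\<in>C. sat_literal a l)"

definition unsatisfiable :: "'v cnf \<Rightarrow> bool" where
  "unsatisfiable F \<longleftrightarrow> (\<nexists>a. sat_cnf a F)"

definition hitting_formula :: "'v cnf \<Rightarrow> bool" where
  "hitting_formula H \<longleftrightarrow> is_cnf H \<and>
     (\<forall>C\<in>H. \<forall>D\<in>H. C \<noteq> D \<longrightarrow> (\<exists>l\<in>C. complement l \<in> D))"

definition hitting_refutation :: "'v cnf \<Rightarrow> 'v cnf \<Rightarrow> bool" where
  "hitting_refutation F H \<longleftrightarrow>
     hitting_formula H \<and> unsatisfiable H \<and> (\<forall>C\<in>H. \<exists>C'\<in>F. C' \<subseteq> C)"

definition resolves_to :: "'v clause \<Rightarrow> 'v clause \<Rightarrow> 'v clause \<Rightarrow> bool" where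
  "resolves_to A B E \<longleftrightarrow>
     (\<exists>x. Pos x \<in> A \<and> Neg x \<in> B \<and> E = (A - {Pos x}) \<union> (B - {Neg x}))"

text \<open>
  A resolution proof is a list of lines. \<open>Resolvent i j C\<close> is a line with clause \<open>C\<close>,
  derived from the clauses on the earlier lines number \<open>i\<close> and \<open>j\<close> (counted from 0).
  A clause may occur on several lines, and each of them is counted.
\<close>

datatype 'v line =
    Axiom (line_clause: "'v clause")
  | is_Resolvent: Resolvent nat nat (line_clause: "'v clause")

fun premise_lines :: "'v line \<Rightarrow> nat list" where
  "premise_lines (Axiom C) = []"
| "premise_lines (Resolvent i j C) = [i, j]"

definition valid_line :: "'v cnf \<Rightarrow> 'v line list \<Rightarrow> nat \<Rightarrow> bool" where
  "valid_line F P k \<longleftrightarrow>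
     (case P ! k of
        Axiom C \<Rightarrow> C \<in> F
      | Resolvent i j C \<Rightarrow>
          i < k \<and> j < k \<and> resolves_to (line_clause (P ! i)) (line_clause (P ! j)) C)"

definition resolution_refutation :: "'v cnf \<Rightarrow> 'v line list \<Rightarrow> bool" where
  "resolution_refutation F P \<longleftrightarrow>
     P \<noteq> [] \<and> (\<forall>k<length P. valid_line F P k) \<and> line_clause (last P) = {}"

text \<open>
  Only derived lines are restricted: a line holding a clause of \<open>F\<close> may serve as a premise
  repeatedly. Listing it anew for each use would change the number of lines by
  at most a constant factor.
\<close>

definition tree_like :: "'v line list \<Rightarrow> bool" where
  "tree_like P \<longleftrightarrow>
     (\<forall>k<length P. is_Resolvent (P ! k) \<longrightarrow> count_list (concat (map premise_lines P)) k \<le> 1)"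

end

theory Submission
  imports Defs
begin

text \<open>
  Build a decision tree for the falsified clause. By a union bound, a hitting refutation
  with \<open>m\<close> clauses has a clause \<open>C\<close> of some width \<open>w \<le> log 2 m\<close>. All other clauses clash
  with \<open>C\<close>, so some literal \<open>l\<close> of \<open>C\<close> clashes with at least \<open>(m - 1) / w\<close> of them. Falsifying
  \<open>l\<close> satisfies all these clauses, and satisfying \<open>l\<close> satisfies at least \<open>C\<close>; what remains
  is again a hitting refutation. Branching on \<open>l\<close> thus gives at most \<open>S m\<close> leaves, where
  \<open>S m \<le> S (m - 1) + S (m - (m - 1) / w)\<close>, and \<open>2 powr (2 * log 2 m ^ 3)\<close> dominates
  this recurrence.
\<close>

section \<open>From resolution trees to line lists\<close>

text \<open>The number counts leaves. A binary tree with \<open>n\<close> leaves has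
  \<open>2 * n - 1\<close> nodes, so it fixes the number of lines, and the recurrence becomes a
  plain sum without index arithmetic.\<close>

inductive resolution_tree :: "'v cnf \<Rightarrow> nat \<Rightarrow> 'v clause \<Rightarrow> bool" for F where
  leaf: "C \<in> F \<Longrightarrow> resolution_tree F 1 C"
| node: "resolution_tree F a A \<Longrightarrow> resolution_tree F b B \<Longrightarrow> resolves_to A B E
    \<Longrightarrow> resolution_tree F (a + b) E"

fun shift_line :: "nat \<Rightarrow> 'v line \<Rightarrow> 'v line" where
  "shift_line n (Axiom C) = Axiom C"
| "shift_line n (Resolvent i j C) = Resolvent (n + i) (n + j) C"

lemma line_clause_shift_line [simp]: "line_clause (shift_line n l) = line_clause l"
  by (cases l) auto

lemma concat_premise_lines_shift_line:
  "concat (map premise_lines (map (shift_line n) P))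
    = map ((+) n) (concat (map premise_lines P))"
proof (induction P)
  case (Cons l P)
  then show ?case by (cases l) auto
qed simp

lemma valid_line_append1:
  "k < length P \<Longrightarrow> valid_line F (P @ Q) k \<longleftrightarrow> valid_line F P k"
  by (cases "P ! k") (auto simp: valid_line_def nth_append)

lemma valid_line_append_shift:
  assumes "k < length Q" "valid_line F Q k"
  shows "valid_line F (P @ map (shift_line (length P)) Q) (length P + k)"
  using assms by (cases "Q ! k") (auto simp: valid_line_def nth_append)

lemma resolution_tree_lines:
  assumes "resolution_tree F n E"
  shows "\<exists>P. P \<noteq> [] \<and> length P + 1 = 2 * n \<and> (\<forall>k<length P. valid_line F P k)
    \<and> line_clause (last P) = E \<and> distinct (concat (map premise_lines P))
    \<and> set (concat (map premise_lines P)) \<subseteq> {..<length P - 1}"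
  using assms
proof induction
  case (leaf C)
  show ?case
    by (rule exI[of _ "[Axiom C]"]) (use leaf in \<open>auto simp: valid_line_def\<close>)
next
  case (node a A b B E)
  from node.IH obtain P Q where
    P: "P \<noteq> []" "length P + 1 = 2 * a" "\<forall>k<length P. valid_line F P k"
      "line_clause (last P) = A" "distinct (concat (map premise_lines P))"
      "set (concat (map premise_lines P)) \<subseteq> {..<length P - 1}" and
    Q: "Q \<noteq> []" "length Q + 1 = 2 * b" "\<forall>k<length Q. valid_line F Q k"
      "line_clause (last Q) = B" "distinct (concat (map premise_lines Q))"
      "set (concat (map premise_lines Q)) \<subseteq> {..<length Q - 1}"
    by blast
  define p q where "p = length P" and "q = length Q"
  have pq: "p > 0" "q > 0" using P(1) Q(1) by (auto simp: p_def q_def)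
  define R where "R = P @ map (shift_line p) Q"
  define X where "X = concat (map premise_lines P)"
  define Y where "Y = concat (map premise_lines Q)"
  define S where "S = R @ [Resolvent (p - 1) (p + q - 1) E]"
  have lenR: "length R = p + q" by (simp add: R_def p_def q_def)
  have validR: "valid_line F R k" if "k < p + q" for k
  proof (cases "k < p")
    case True
    then show ?thesis using P(3) by (simp add: R_def p_def valid_line_append1)
  next
    case False
    then have "k = length P + (k - p)" "k - p < length Q"
      using that by (auto simp: p_def q_def)
    then show ?thesis
      using valid_line_append_shift[of "k - p" Q F P] Q(3) by (simp add: R_def p_def)
  qed
  have "R ! (p - 1) = last P"
    using P(1) by (simp add: R_def nth_append p_def last_conv_nth)
  moreover have "R ! (p + q - 1) = shift_line p (last Q)"
  proof -
    have "\<not> p + q - 1 < p" "p + q - 1 - p = q - 1" using pq by linarith+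
    then show ?thesis using Q(1) by (simp add: R_def nth_append p_def q_def last_conv_nth)
  qed
  ultimately have last: "valid_line F S (p + q)"
    using node.hyps P(4) Q(4) pq lenR by (auto simp: valid_line_def S_def nth_append)
  have valid: "\<forall>k<length S. valid_line F S k"
  proof (intro allI impI)
    fix k assume "k < length S"
    then have "k < p + q \<or> k = p + q" by (auto simp: S_def lenR)
    then show "valid_line F S k"
      using last validR[of k] lenR by (auto simp: S_def valid_line_append1)
  qed
  have prem: "concat (map premise_lines S) = X @ map ((+) p) Y @ [p - 1, p + q - 1]"
    unfolding S_def R_def X_def Y_def map_append concat_append concat_premise_lines_shift_line
    by simp
  have X: "set X \<subseteq> {..<p - 1}" "distinct X" and Y: "set Y \<subseteq> {..<q - 1}" "distinct Y"
    using P Q by (simp_all add: X_def Y_def p_def q_def)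
  have "distinct (map ((+) p) Y)" using Y by (simp add: distinct_map)
  moreover have "set (map ((+) p) Y) \<subseteq> {p..<p + q - 1}"
    using Y pq by fastforce
  ultimately have "distinct (X @ map ((+) p) Y @ [p - 1, p + q - 1])"
    using X pq by fastforce
  moreover have "set (X @ map ((+) p) Y @ [p - 1, p + q - 1]) \<subseteq> {..<p + q}"
    using X \<open>set (map ((+) p) Y) \<subseteq> _\<close> pq by fastforce
  ultimately show ?case
    using valid P(2) Q(2) lenR prem pq
    by (intro exI[of _ S]) (auto simp: S_def p_def q_def)
qed

lemma count_list_distinct_le: "distinct xs \<Longrightarrow> count_list xs x \<le> 1"
  by (induction xs) auto

lemma resolution_tree_refutation:
  assumes "resolution_tree F n {}"
  shows "\<exists>P. resolution_refutation F P \<and> tree_like P \<and> length P < 2 * n"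
proof -
  obtain P where P: "P \<noteq> []" "length P + 1 = 2 * n" "\<forall>k<length P. valid_line F P k"
    "line_clause (last P) = {}" "distinct (concat (map premise_lines P))"
    using resolution_tree_lines[OF assms] by blast
  have "resolution_refutation F P"
    unfolding resolution_refutation_def using P(1,3,4) by (intro conjI)
  moreover have "tree_like P"
    unfolding tree_like_def by (intro allI impI count_list_distinct_le[OF P(5)])
  moreover have "length P < 2 * n" using P(2) by simp
  ultimately show ?thesis by (intro exI[of _ P] conjI)
qed

section \<open>Short clauses\<close>

text \<open>For a clause, this means non-tautological; for the literals falsified along a branch, it
  means that they describe a partial assignment.\<close>

definition consistent :: "'v clause \<Rightarrow> bool" where
  "consistent C \<longleftrightarrow> (\<forall>l\<in>C. complement l \<notin> C)"

definition falsifies :: "('v \<Rightarrow> bool) \<Rightarrow> 'v clause \<Rightarrow> bool" where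
  "falsifies a C \<longleftrightarrow> (\<forall>l\<in>C. \<not> sat_literal a l)"

fun var_of :: "'v literal \<Rightarrow> 'v" where
  "var_of (Pos x) = x"
| "var_of (Neg x) = x"

lemma all_literal: "(\<forall>l. P l) \<longleftrightarrow> (\<forall>x. P (Pos x)) \<and> (\<forall>x. P (Neg x))"
  by (metis literal.exhaust)

lemma ex_literal: "(\<exists>l. P l) \<longleftrightarrow> (\<exists>x. P (Pos x)) \<or> (\<exists>x. P (Neg x))"
  by (metis literal.exhaust)

lemma complement_complement [simp]: "complement (complement l) = l"
  by (cases l) auto

lemma complement_neq [simp]: "complement l \<noteq> l" "l \<noteq> complement l"
  by (cases l; simp)+

lemma sat_literal_complement [simp]: "sat_literal a (complement l) \<longleftrightarrow> \<not> sat_literal a l"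
  by (cases l) auto

lemma falsifies_Un: "falsifies a (C \<union> D) \<longleftrightarrow> falsifies a C \<and> falsifies a D"
  by (auto simp: falsifies_def)

lemma falsifies_imp_consistent: "falsifies a C \<Longrightarrow> consistent C"
  unfolding falsifies_def consistent_def by (metis sat_literal_complement)

lemma inj_on_var_of: "consistent C \<Longrightarrow> inj_on var_of C"
  unfolding inj_on_def consistent_def Ball_def all_literal by auto

text \<open>Falsifying \<open>C\<close> fixes the values of exactly \<open>card C\<close> distinct
  variables and leaves the others free. Assignments on \<open>V\<close> are encoded as sets of true
  variables; the product form avoids division.\<close>

lemma card_falsifying:
  assumes "finite V" "var_of ` C \<subseteq> V" "consistent C"
  shows "card {S \<in> Pow V. falsifies (\<lambda>x. x \<in> S) C} * 2 ^ card C = 2 ^ card V"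
proof -
  define N where "N = {x. Neg x \<in> C}"
  define W where "W = V - var_of ` C"
  have f: "falsifies (\<lambda>x. x \<in> S) C \<longleftrightarrow> N \<subseteq> S \<and> (\<forall>x\<in>S. Pos x \<notin> C)" for S
  proof -
    have "falsifies (\<lambda>x. x \<in> S) C \<longleftrightarrow> (\<forall>x. Pos x \<in> C \<longrightarrow> x \<notin> S) \<and> (\<forall>x. Neg x \<in> C \<longrightarrow> x \<in> S)"
      unfolding falsifies_def Ball_def by (subst all_literal) auto
    then show ?thesis by (auto simp: N_def)
  qed
  have vars: "x \<in> var_of ` C \<longleftrightarrow> Pos x \<in> C \<or> x \<in> N" for x
    unfolding N_def image_iff Bex_def by (subst ex_literal) auto
  have con: "x \<in> N \<Longrightarrow> Pos x \<notin> C" for x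
    using assms(3) unfolding N_def consistent_def by force
  \<comment> \<open>\<open>N\<close> holds the variables forced to be true and \<open>W\<close> the
    free ones: a falsifying set is \<open>N\<close> plus an arbitrary subset of
    \<open>W\<close>.\<close>
  have "bij_betw (\<lambda>S. S \<union> N) (Pow W) {S \<in> Pow V. falsifies (\<lambda>x. x \<in> S) C}"
  proof (rule bij_betw_byWitness[where f' = "\<lambda>S. S - N"])
    show "\<forall>S\<in>Pow W. S \<union> N - N = S" using vars by (auto simp: W_def)
    show "\<forall>S\<in>{S \<in> Pow V. falsifies (\<lambda>x. x \<in> S) C}. S - N \<union> N = S" by (auto simp: f)
    show "(\<lambda>S. S \<union> N) ` Pow W \<subseteq> {S \<in> Pow V. falsifies (\<lambda>x. x \<in> S) C}"
      using vars con assms(2) unfolding f W_def by blast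
    show "(\<lambda>S. S - N) ` {S \<in> Pow V. falsifies (\<lambda>x. x \<in> S) C} \<subseteq> Pow W"
      using vars unfolding f W_def by blast
  qed
  then have "card {S \<in> Pow V. falsifies (\<lambda>x. x \<in> S) C} = 2 ^ card W"
    using assms(1) by (simp add: W_def bij_betw_same_card[symmetric] card_Pow)
  moreover have "card W + card C = card V"
  proof -
    have "card W = card V - card C"
      using assms by (simp add: W_def card_Diff_subset finite_subset card_image inj_on_var_of)
    moreover have "card C \<le> card V"
      using assms by (metis card_image card_mono inj_on_var_of)
    ultimately show ?thesis by simp
  qed
  ultimately show ?thesis by (metis power_add)
qed

text \<open>Union bound: among the assignments falsifying \<open>\<rho>\<close>, a fraction
  \<open>1 / 2 ^ card (C - \<rho>)\<close> also falsifies \<open>C\<close>. If all these fractions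
  were below \<open>1 / card H\<close>, the clauses could not cover everything.\<close>

lemma obtain_short_clause:
  assumes "finite H" "finite \<rho>" "consistent \<rho>"
    and fin: "\<And>C. C \<in> H \<Longrightarrow> finite C"
    and con: "\<And>C. C \<in> H \<Longrightarrow> consistent (C \<union> \<rho>)"
    and cover: "\<And>a. falsifies a \<rho> \<Longrightarrow> \<exists>C\<in>H. falsifies a C"
  obtains C where "C \<in> H" "2 ^ card (C - \<rho>) \<le> card H"
proof (rule ccontr)
  assume "\<not> thesis"
  then have contr: "\<not> 2 ^ card (C - \<rho>) \<le> card H" if "C \<in> H" for C
    using that \<open>\<And>C. C \<in> H \<Longrightarrow> 2 ^ card (C - \<rho>) \<le> card H \<Longrightarrow> thesis\<close> by blast
  define V where "V = var_of ` (\<Union>H \<union> \<rho>)"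
  define A where "A C = {S \<in> Pow V. falsifies (\<lambda>x. x \<in> S) C}" for C
  have V: "finite V" using assms by (simp add: V_def)
  then have finA: "finite (A C)" for C by (simp add: A_def)
  have card\<rho>: "card (A \<rho>) * 2 ^ card \<rho> = 2 ^ card V"
    unfolding A_def using assms V by (intro card_falsifying) (auto simp: V_def)
  then have pos: "card (A \<rho>) > 0"
    by (metis gr0I mult_0 power_not_zero zero_neq_numeral)
  then obtain S where "S \<in> A \<rho>" by (metis card_gt_0_iff ex_in_conv)
  \<comment> \<open>Nonemptiness makes the sum of strict inequalities below strict.\<close>
  then have "H \<noteq> {}" using cover[of "\<lambda>x. x \<in> S"] by (auto simp: A_def)
  have less: "card H * card (A (C \<union> \<rho>)) < card (A \<rho>)" if C: "C \<in> H" for C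
  proof -
    have "card (C \<union> \<rho>) = card (C - \<rho>) + card \<rho>"
      using card_Un_disjoint[of "C - \<rho>" \<rho>] fin[OF C] assms(2) by (simp add: Int_commute)
    moreover have eq: "card (A (C \<union> \<rho>)) * 2 ^ card (C \<union> \<rho>) = 2 ^ card V"
      unfolding A_def using C con V by (intro card_falsifying) (auto simp: V_def)
    ultimately have "card (A (C \<union> \<rho>)) * 2 ^ card (C - \<rho>) * 2 ^ card \<rho>
        = card (A \<rho>) * 2 ^ card \<rho>"
      using card\<rho> by (simp add: power_add algebra_simps)
    then have e: "card (A (C \<union> \<rho>)) * 2 ^ card (C - \<rho>) = card (A \<rho>)" by simp
    moreover have "card H < 2 ^ card (C - \<rho>)" using contr[OF C] by linarith
    moreover have "card (A (C \<union> \<rho>)) > 0" using e pos by (metis gr0I mult_0)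
    ultimately show ?thesis by (metis mult.commute mult_less_mono1)
  qed
  have "A \<rho> \<subseteq> (\<Union>C\<in>H. A (C \<union> \<rho>))"
    using cover by (auto simp: A_def falsifies_Un)
  then have "card (A \<rho>) \<le> card (\<Union>C\<in>H. A (C \<union> \<rho>))"
    using finA assms(1) by (intro card_mono) auto
  also have "\<dots> \<le> (\<Sum>C\<in>H. card (A (C \<union> \<rho>)))"
    by (rule card_UN_le[OF assms(1)])
  finally have "card H * card (A \<rho>) \<le> (\<Sum>C\<in>H. card H * card (A (C \<union> \<rho>)))"
    by (simp add: sum_distrib_left[symmetric])
  also have "\<dots> < (\<Sum>C\<in>H. card (A \<rho>))"
    using less \<open>H \<noteq> {}\<close> assms(1) by (intro sum_strict_mono) auto
  finally show False by simp
qed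

section \<open>The recurrence\<close>

definition leaf_bound :: "nat \<Rightarrow> real" where
  "leaf_bound m = 2 powr (2 * log 2 (real m) ^ 3)"

text \<open>Includes \<open>m = 0\<close>, since the logarithm of 0 is 0 by convention; likewise
  \<open>leaf_bound 0 = 1\<close>.\<close>

lemma log2_nonneg: "0 \<le> log 2 (real m)"
  by (cases m) (auto simp: log_def)

lemma leaf_bound_ge_1: "1 \<le> leaf_bound m"
  unfolding leaf_bound_def by (rule ge_one_powr_ge_zero) (simp_all add: log2_nonneg)

lemma leaf_bound_mono:
  assumes "k \<le> m"
  shows "leaf_bound k \<le> leaf_bound m"
proof (cases "k = 0")
  case True
  then show ?thesis using leaf_bound_ge_1[of m] by (simp add: leaf_bound_def log_def)
next
  case False
  then have "log 2 (real k) ^ 3 \<le> log 2 (real m) ^ 3"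
    using assms by (intro power_mono log2_nonneg) simp
  then show ?thesis by (simp add: leaf_bound_def)
qed

text \<open>With \<open>K \<le> L\<close> for the two logarithms,
  \<open>K ^ 3 \<le> L ^ 2 * K\<close>, so a drop of the logarithm by \<open>\<delta>\<close> lowers
  the exponent in \<open>leaf_bound\<close> by \<open>2 * L ^ 2 * \<delta>\<close>.\<close>

lemma log2_cube_decrease:
  assumes "k \<le> m" "log 2 (real k) \<le> log 2 (real m) - \<delta>"
  shows "2 * log 2 (real k) ^ 3 \<le> 2 * log 2 (real m) ^ 3 - 2 * log 2 (real m) ^ 2 * \<delta>"
proof -
  let ?L = "log 2 (real m)" and ?K = "log 2 (real k)"
  have KL: "?K \<le> ?L"
    using assms(1) log2_nonneg[of m] by (cases "k = 0") (auto simp: log_def divide_right_mono)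
  have "?K ^ 3 = ?K ^ 2 * ?K" by (simp add: power3_eq_cube power2_eq_square)
  also have "\<dots> \<le> ?L ^ 2 * ?K"
    using KL log2_nonneg by (intro mult_right_mono power_mono) auto
  also have "\<dots> \<le> ?L ^ 2 * (?L - \<delta>)"
    using assms(2) by (intro mult_left_mono) auto
  also have "\<dots> = ?L ^ 3 - ?L ^ 2 * \<delta>"
    by (simp add: algebra_simps power3_eq_cube power2_eq_square)
  finally show ?thesis by simp
qed

lemma log2_mult_one_minus_le:
  assumes "0 < x" "y < 1"
  shows "log 2 (x * (1 - y)) \<le> log 2 x - y / ln 2"
proof -
  have "ln (1 - y) \<le> - y" using ln_le_minus_one[of "1 - y"] assms by simp
  then have "log 2 (1 - y) \<le> - y / ln 2"
    unfolding log_def by (intro divide_right_mono) auto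
  then show ?thesis using assms by (simp add: log_mult)
qed

text \<open>Here \<open>k\<close> clauses survive on the good branch. Its bound is at most a
  fraction \<open>1 / m\<close> of \<open>leaf_bound m\<close>, while losing a single clause leaves
  at most a fraction \<open>m / (m + 2)\<close>. The two fractions add up to at most 1 once
  \<open>m \<ge> 2\<close>.\<close>

lemma leaf_bound_recurrence:
  assumes w: "1 \<le> w" "2 ^ w \<le> m" and k: "m - 1 \<le> w * (m - k)" "k \<le> m"
  shows "leaf_bound (m - 1) + leaf_bound k \<le> leaf_bound m"
proof -
  let ?L = "log 2 (real m)" and ?x = "real m"
  have "(2::nat) ^ 1 \<le> 2 ^ w" using w(1) by (intro power_increasing) auto
  then have m: "2 \<le> m" using w(2) by simp
  have "2 powr real w \<le> real m"
    using w(2) by (simp add: powr_realpow)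
  then have wL: "real w \<le> ?L" using m by (simp add: le_log_iff)
  then have L: "1 \<le> ?L" using w(1) by linarith
  have ln2: "0 < ln (2::real)" "ln (2::real) \<le> 1" using ln_le_minus_one[of "2::real"] by auto
  have kB: "leaf_bound k \<le> leaf_bound m / ?x"
  proof -
    have "2 * log 2 (real k) ^ 3 \<le> 2 * ?L ^ 3 - ?L"
    proof (cases "k = 0")
      case True
      have "?L \<le> ?L ^ 3" using power_increasing[of 1 3 ?L] L by simp
      then have "?L \<le> 2 * ?L ^ 3" using L by linarith
      then show ?thesis using True by (simp add: log_def)
    next
      case False
      have "real (m - 1) \<le> real (w * (m - k))" using k(1) of_nat_le_iff by blast
      then have "?x - 1 \<le> real w * (?x - real k)" using m k(2) by (simp add: of_nat_diff)
      also have "\<dots> \<le> ?L * (?x - real k)"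
        using wL k(2) by (intro mult_right_mono) auto
      \<comment> \<open>Uses \<open>?x / 2 \<le> ?x - 1\<close>. The relative loss is thus at least
        \<open>1 / (2 * ?L)\<close>, which lowers the exponent by \<open>?L\<close>, that is,
        divides the bound by \<open>?x\<close>.\<close>
      finally have "?x / 2 \<le> ?L * (?x - real k)" using m by simp
      then have "real k \<le> ?x * (1 - 1 / (2 * ?L))" using L by (simp add: field_simps)
      then have "log 2 (real k) \<le> log 2 (?x * (1 - 1 / (2 * ?L)))"
        using False by (intro log_mono) auto
      also have "\<dots> \<le> ?L - 1 / (2 * ?L) / ln 2"
      proof (rule log2_mult_one_minus_le)
        show "1 / (2 * ?L) < 1" using L by (subst divide_less_eq_1_pos) linarith+
      qed (use m in simp)
      also have "\<dots> \<le> ?L - 1 / (2 * ?L)"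
        using L ln2 by (simp add: field_simps)
      finally have "2 * log 2 (real k) ^ 3 \<le> 2 * ?L ^ 3 - 2 * ?L ^ 2 * (1 / (2 * ?L))"
        by (rule log2_cube_decrease[OF k(2)])
      also have "2 * ?L ^ 2 * (1 / (2 * ?L)) = ?L" using L by (simp add: power2_eq_square)
      finally show ?thesis .
    qed
    then have "leaf_bound k \<le> 2 powr (2 * ?L ^ 3 - ?L)" by (simp add: leaf_bound_def)
    also have "\<dots> = leaf_bound m / ?x" using m by (simp add: leaf_bound_def powr_diff)
    finally show ?thesis .
  qed
  have "leaf_bound (m - 1) * (1 + 2 / ?x) \<le> leaf_bound m"
  proof -
    have "real (m - 1) = ?x * (1 - 1 / ?x)" using m by (simp add: of_nat_diff field_simps)
    then have "log 2 (real (m - 1)) \<le> ?L - 1 / ?x / ln 2"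
      using log2_mult_one_minus_le[of ?x "1 / ?x"] m by simp
    from log2_cube_decrease[OF _ this]
    have "2 * log 2 (real (m - 1)) ^ 3 \<le> 2 * ?L ^ 3 - 2 * ?L ^ 2 * (1 / ?x / ln 2)" by simp
    also have "\<dots> \<le> 2 * ?L ^ 3 - 2 * 1 * (1 / ?x / ln 2)"
      using L ln2 one_le_power[OF L, of 2] by (intro diff_left_mono mult_right_mono) auto
    finally have "leaf_bound (m - 1) \<le> 2 powr (2 * ?L ^ 3 - 2 * (1 / ?x / ln 2))"
      by (simp add: leaf_bound_def)
    \<comment> \<open>The \<open>ln 2\<close> cancels in the change of base from 2 to
      \<open>exp\<close>.\<close>
    also have "\<dots> = leaf_bound m / exp (2 / ?x)"
      using ln2 by (simp add: leaf_bound_def powr_diff) (simp add: powr_def)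
    finally have "leaf_bound (m - 1) * exp (2 / ?x) \<le> leaf_bound m"
      by (simp add: field_simps)
    moreover have "leaf_bound (m - 1) * (1 + 2 / ?x) \<le> leaf_bound (m - 1) * exp (2 / ?x)"
      using leaf_bound_ge_1[of "m - 1"] by (intro mult_left_mono exp_ge_add_one_self) auto
    ultimately show ?thesis by linarith
  qed
  then have "leaf_bound (m - 1) \<le> leaf_bound m * (?x / (?x + 2))"
    using m by (simp add: field_simps)
  moreover have "leaf_bound m * (?x / (?x + 2)) + leaf_bound m / ?x
      = leaf_bound m * (?x / (?x + 2) + 1 / ?x)" by (simp add: field_simps)
  moreover have "leaf_bound m * (?x / (?x + 2) + 1 / ?x) \<le> leaf_bound m * 1"
  proof (rule mult_left_mono)
    have "?x / (?x + 2) = 1 - 2 / (?x + 2)" by (simp add: field_simps)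
    moreover have "1 / ?x \<le> 2 / (?x + 2)" using m by (simp add: frac_le_eq divide_le_0_iff)
    ultimately show "?x / (?x + 2) + 1 / ?x \<le> 1" by linarith
  qed (use leaf_bound_ge_1[of m] in simp)
  ultimately show ?thesis using kB by linarith
qed

section \<open>The decision tree\<close>

text \<open>A subtree whose clause lacks its branching literal already derives a subset of
  \<open>\<rho>\<close>, and the other subtree is discarded. Otherwise the two clauses are resolved.
  Asking only for a subset of \<open>\<rho>\<close> makes weakening steps unnecessary.\<close>

lemma resolution_tree_branch:
  assumes "resolution_tree F a A" "A \<subseteq> insert l \<rho>"
    and "resolution_tree F b B" "B \<subseteq> insert (complement l) \<rho>"
  shows "\<exists>n E. resolution_tree F n E \<and> E \<subseteq> \<rho> \<and> n \<le> a + b"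
proof -
  consider "l \<notin> A" | "complement l \<notin> B" | "l \<in> A" "complement l \<in> B" by blast
  then show ?thesis
  proof cases
    case 1
    then show ?thesis using assms(1,2) by (intro exI[of _ a] exI[of _ A]) auto
  next
    case 2
    then show ?thesis using assms(3,4) by (intro exI[of _ b] exI[of _ B]) auto
  next
    case 3
    let ?E = "(A - {l}) \<union> (B - {complement l})"
    have "resolution_tree F (a + b) ?E"
    proof (cases l)
      case (Pos x)
      then have "resolves_to A B ?E"
        using 3 unfolding resolves_to_def by (intro exI[of _ x]) simp
      then show ?thesis by (rule resolution_tree.node[OF assms(1,3)])
    next
      case (Neg x)
      then have "resolves_to B A ?E"
        using 3 unfolding resolves_to_def by (intro exI[of _ x]) (simp add: Un_commute)
      then have "resolution_tree F (b + a) ?E" by (rule resolution_tree.node[OF assms(3,1)])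
      then show ?thesis by (simp add: add.commute)
    qed
    then show ?thesis using assms(2,4) by (intro exI[of _ "a + b"] exI[of _ ?E]) auto
  qed
qed

text \<open>
  The set \<open>\<rho>\<close> holds the literals falsified along a branch. Clauses satisfied by the
  branch have been dropped from \<open>H\<close>, the remaining ones are kept unrestricted.
\<close>

lemma resolution_tree_of_hitting:
  assumes "finite H" "finite \<rho>" "consistent \<rho>"
    and "\<And>C. C \<in> H \<Longrightarrow> finite C"
    and "\<And>C. C \<in> H \<Longrightarrow> consistent (C \<union> \<rho>)"
    and "\<And>C D. C \<in> H \<Longrightarrow> D \<in> H \<Longrightarrow> C \<noteq> D \<Longrightarrow> \<exists>l\<in>C. complement l \<in> D"
    and "\<And>C. C \<in> H \<Longrightarrow> \<exists>C'\<in>F. C' \<subseteq> C"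
    and "\<And>a. falsifies a \<rho> \<Longrightarrow> \<exists>C\<in>H. falsifies a C"
  shows "\<exists>n E. resolution_tree F n E \<and> E \<subseteq> \<rho> \<and> real n \<le> leaf_bound (card H)"
  using assms
proof (induction "card H" arbitrary: H \<rho> rule: less_induct)
  case less
  note fin = less.prems(4) and con = less.prems(5) and clash = less.prems(6)
    and sub = less.prems(7) and cover = less.prems(8)
  define m where "m = card H"
  obtain C where C: "C \<in> H" "2 ^ card (C - \<rho>) \<le> m"
    unfolding m_def using obtain_short_clause[OF less.prems(1-5) cover] by blast
  show ?case
  \<comment> \<open>The branch ends when it falsifies \<open>C\<close>. This covers
    \<open>m = 1\<close>, where the width bound leaves no literal outside
    \<open>\<rho>\<close>.\<close>
  proof (cases "C \<subseteq> \<rho>")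
    case True
    from sub[OF C(1)] obtain C' where "C' \<in> F" "C' \<subseteq> C" by blast
    then show ?thesis
      using True leaf_bound_ge_1[of "card H"] resolution_tree.leaf[of C' F]
      by (intro exI[of _ 1] exI[of _ C']) auto
  next
    case False
    define w where "w = card (C - \<rho>)"
    have finC: "finite (C - \<rho>)" using fin[OF C(1)] by simp
    then have w: "1 \<le> w" using False by (simp add: w_def Suc_le_eq card_gt_0_iff)
    define N where "N l = {D \<in> H. complement l \<in> D}" for l
    \<comment> \<open>Averaging: the sets \<open>N l\<close> of clauses satisfied by falsifying
      \<open>l\<close> cover \<open>H - {C}\<close>, and there are \<open>w\<close> such
      literals.\<close>
    have "\<exists>l\<in>C - \<rho>. m - 1 \<le> w * card (N l)"
    proof (rule ccontr)
      assume contr: "\<not> ?thesis"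
      have "H - {C} \<subseteq> (\<Union>l\<in>C - \<rho>. N l)"
      proof
        fix D assume D: "D \<in> H - {C}"
        then obtain l where l: "l \<in> C" "complement l \<in> D" using clash[of C D] C(1) by auto
        \<comment> \<open>Otherwise \<open>D\<close> would contain the complement of a literal of
          \<open>\<rho>\<close> and would already have been dropped.\<close>
        then have "l \<notin> \<rho>" using con[of D] D by (force simp: consistent_def)
        then show "D \<in> (\<Union>l\<in>C - \<rho>. N l)" using l D by (auto simp: N_def)
      qed
      then have "card (H - {C}) \<le> card (\<Union>l\<in>C - \<rho>. N l)"
        using finC less.prems(1) by (intro card_mono) (auto simp: N_def)
      also have "\<dots> \<le> (\<Sum>l\<in>C - \<rho>. card (N l))" by (rule card_UN_le[OF finC])
      finally have "m - 1 \<le> (\<Sum>l\<in>C - \<rho>. card (N l))"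
        using C(1) by (simp add: m_def)
      then have "w * (m - 1) \<le> (\<Sum>l\<in>C - \<rho>. w * card (N l))"
        by (simp add: sum_distrib_left[symmetric])
      also have "\<dots> < (\<Sum>l\<in>C - \<rho>. m - 1)"
        using contr finC False by (intro sum_strict_mono) (auto simp: not_le)
      finally show False by (simp add: w_def)
    qed
    then obtain l where l: "l \<in> C" "l \<notin> \<rho>" "m - 1 \<le> w * card (N l)" by blast
    have l': "complement l \<notin> \<rho>" using con[OF C(1)] l by (auto simp: consistent_def)
    \<comment> \<open>\<open>H1\<close> survives when \<open>l\<close> is false, \<open>H2\<close>
      when \<open>l\<close> is true; \<open>H2\<close> loses at least \<open>C\<close>.\<close>
    define H1 where "H1 = {D \<in> H. complement l \<notin> D}"
    define H2 where "H2 = {D \<in> H. l \<notin> D}"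
    have "(2::nat) ^ 1 \<le> 2 ^ w" using w by (intro power_increasing) auto
    then have m: "2 \<le> m" using C(2) by (simp add: w_def)
    have "H1 = H - N l" by (auto simp: H1_def N_def)
    moreover have NH: "N l \<subseteq> H" by (auto simp: N_def)
    ultimately have cardH1: "card H1 = m - card (N l)" and NM: "card (N l) \<le> m"
      using less.prems(1) by (simp_all add: m_def card_Diff_subset finite_subset card_mono)
    have "card (N l) \<noteq> 0" using l(3) m by (intro notI) simp
    then have H1: "card H1 < card H" using cardH1 m by (simp add: m_def)
    have "H2 \<subseteq> H - {C}" using l by (auto simp: H2_def)
    then have cardH2: "card H2 \<le> m - 1"
      using card_mono[of "H - {C}" H2] less.prems(1) C(1) by (simp add: m_def)
    then have H2: "card H2 < card H" using m by (simp add: m_def)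
    \<comment> \<open>Stated for a general \<open>k\<close> to serve both branches:
      \<open>k = l\<close> gives \<open>H1\<close>, and \<open>k = complement l\<close> gives
      \<open>H2\<close>.\<close>
    have branch: "\<exists>n E. resolution_tree F n E \<and> E \<subseteq> insert k \<rho>
        \<and> real n \<le> leaf_bound (card {D \<in> H. complement k \<notin> D})"
      if k: "card {D \<in> H. complement k \<notin> D} < card H" "k \<notin> \<rho>" "complement k \<notin> \<rho>" for k
    proof (rule less.hyps[OF k(1)])
      show "consistent (insert k \<rho>)"
        using less.prems(3) k by (auto simp: consistent_def)
      show "consistent (D \<union> insert k \<rho>)" if "D \<in> {D \<in> H. complement k \<notin> D}" for D
        using con[of D] that k by (auto simp: consistent_def)
      show "\<exists>D\<in>{D \<in> H. complement k \<notin> D}. falsifies a D" if "falsifies a (insert k \<rho>)" for a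
      proof -
        have "falsifies a \<rho>" "\<not> sat_literal a k" using that by (auto simp: falsifies_def)
        then obtain D where D: "D \<in> H" "falsifies a D" using cover by blast
        then have "complement k \<notin> D"
          using \<open>\<not> sat_literal a k\<close> by (auto simp: falsifies_def)
        then show ?thesis using D by blast
      qed
      show "\<exists>k\<in>D. complement k \<in> E"
        if "D \<in> {D \<in> H. complement k \<notin> D}" "E \<in> {D \<in> H. complement k \<notin> D}" "D \<noteq> E" for D E
        using clash[of D E] that by simp
    qed (use less.prems(1,2) fin sub in simp_all)
    obtain a A where A: "resolution_tree F a A" "A \<subseteq> insert l \<rho>" "real a \<le> leaf_bound (card H1)"
      using branch[of l] H1 l l' by (auto simp: H1_def)
    obtain b B where B: "resolution_tree F b B" "B \<subseteq> insert (complement l) \<rho>"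
      "real b \<le> leaf_bound (card H2)"
      using branch[of "complement l"] H2 l l' by (auto simp: H2_def)
    obtain n E where E: "resolution_tree F n E" "E \<subseteq> \<rho>" "n \<le> a + b"
      using resolution_tree_branch[OF A(1,2) B(1,2)] by blast
    have "leaf_bound (m - 1) + leaf_bound (card H1) \<le> leaf_bound m"
      using leaf_bound_recurrence[of w m "card H1"] w C(2) l(3) cardH1 NM by (simp add: w_def)
    then have "real n \<le> leaf_bound m"
      using E(3) A(3) B(3) leaf_bound_mono[OF cardH2] by linarith
    then show ?thesis using E by (auto simp: m_def)
  qed
qed

theorem theorem3p3:
  "\<exists>c::real. c > 0 \<and>
     (\<forall>(F :: 'v cnf) (m :: nat).
        is_cnf F \<longrightarrow>
        (\<exists>H. hitting_refutation F H \<and> card H = m) \<longrightarrow>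
        (\<exists>P. resolution_refutation F P \<and> tree_like P \<and>
             real (length P) \<le> c * 2 powr (2 * (log 2 (real m)) ^ 3)))"
\<comment> \<open>The constant 2 converts leaves into lines.\<close>
proof (intro exI[of _ "2::real"] conjI allI impI)
  fix F :: "'v cnf" and m :: nat
  assume "\<exists>H. hitting_refutation F H \<and> card H = m"
  then obtain H where H: "hitting_refutation F H" "card H = m" by blast
  \<comment> \<open>No assignment falsifies a tautology, so dropping tautologies keeps every
    assignment covered; monotonicity of \<open>leaf_bound\<close> absorbs the smaller size.\<close>
  define G where "G = {C \<in> H. consistent C}"
  have hit: "hitting_formula H" and sub: "\<forall>C\<in>H. \<exists>C'\<in>F. C' \<subseteq> C"
    using H(1) unfolding hitting_refutation_def by simp_all
  have fin: "finite H" and finC: "\<forall>C\<in>H. finite C"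
    and clash: "\<forall>C\<in>H. \<forall>D\<in>H. C \<noteq> D \<longrightarrow> (\<exists>l\<in>C. complement l \<in> D)"
    using hit unfolding hitting_formula_def is_cnf_def by simp_all
  have unsat: "\<exists>C\<in>H. falsifies a C" for a
    using H(1) unfolding hitting_refutation_def unsatisfiable_def sat_cnf_def falsifies_def
    by simp
  \<comment> \<open>At the root nothing is falsified yet, so the derived clause must be
    empty.\<close>
  have "\<exists>n E. resolution_tree F n E \<and> E \<subseteq> {} \<and> real n \<le> leaf_bound (card G)"
  proof (rule resolution_tree_of_hitting)
    show "\<exists>C\<in>G. falsifies a C" for a
      using unsat[of a] falsifies_imp_consistent by (auto simp: G_def)
  qed (use fin finC clash sub in \<open>simp_all add: G_def consistent_def\<close>)
  then obtain n where n: "resolution_tree F n {}" "real n \<le> leaf_bound (card G)" by auto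
  have "card G \<le> m" using fin H(2) by (auto simp: G_def intro: card_mono)
  then have "real n \<le> leaf_bound m" using n(2) leaf_bound_mono[of "card G" m] by linarith
  moreover obtain P where "resolution_refutation F P" "tree_like P" "length P < 2 * n"
    using resolution_tree_refutation[OF n(1)] by blast
  ultimately show "\<exists>P. resolution_refutation F P \<and> tree_like P \<and>
      real (length P) \<le> 2 * 2 powr (2 * (log 2 (real m)) ^ 3)"
    by (intro exI[of _ P]) (auto simp: leaf_bound_def)
qed simp

end
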